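(* For a given expected consolidation cycle length, revised HP1 with a larger quantity parameter achieves larger average order delay than revised HP1 with a smaller quantity parameter; in particular, revised HP1 achieves less average order delay than revised TP1. That is: (1) for integers $1\le q<q'$ and reals $T,T'>0$ such that revised HP1 with parameters $(q,T)$ and revised HP1 with parameters $(q',T')$ have the same expected cycle length, the average order delay of revised HP1 with parameters $(q',T')$ is strictly larger than that of revised HP1 with parameters $(q,T)$; (2) for an integer $q\ge1$ and reals $T,T'>0$ such that revised HP1 with parameters $(q,T)$ and revised TP1 with parameter $T'$ have the same expected cycle length, the average order delay of revised HP1 with parameters $(q,T)$ is strictly smaller than that of revised TP1 with parameter $T'$.
   Context: Customer orders arrive according to a Poisson process $\{N(t)\}_{t\ge 0}$ with rate $\lambda>0$ and $N(0)=0$; $\tau_n$ denotes the arrival time of the $n$-th order, and $a\wedge b=\min(a,b)$. A renewal-type clearing policy is specified by its shipment-release time $\tau$ (the length of one consolidation cycle started at time $0$), with expected cycle length $\mathbb{E}[\tau]\in(0,\infty)$ and average order delay $AOD_\tau=\mathbb{E}\left[\int_0^\tau N(u)\,du\right]/(\lambda\,\mathbb{E}[\tau])$. The revised policies do not allow empty shipments. For $T>0$ let $K_T=\min\{k\ge1: N(kT)\ge1\}$. Revised TP1 with parameter $T$ (dispatch at time $T$ if the load is positive; otherwise continue for further periods of length $T$ until the load at the end of a period is positive) has release time $\tau=K_T T$. Revised HP1 with parameters $q\in\{1,2,\dots\}$ and $T>0$ (dispatch when the load reaches $q$ or when $T$ time units have elapsed, whichever is first, except that if the load is zero after $T$ time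 units no shipment is released and the clock restarts) has release time $\tau=\tau_q\wedge(K_T T)$. *)

theory Defs
  imports "HOL-Probability.Probability"
begin

locale poisson_process = prob_space M for M :: "'a measure" +
  fixes rate :: real and N :: "real \<Rightarrow> 'a \<Rightarrow> nat"
  assumes rate_pos: "rate > 0"
    and measurable_N: "\<And>t. 0 \<le> t \<Longrightarrow> N t \<in> measurable M (count_space UNIV)"
    and N_zero: "\<And>\<omega>. \<omega> \<in> space M \<Longrightarrow> N 0 \<omega> = 0"
    and N_mono: "\<And>\<omega> s t. \<omega> \<in> space M \<Longrightarrow> 0 \<le> s \<Longrightarrow> s \<le> t \<Longrightarrow> N s \<omega> \<le> N t \<omega>"
    and N_right_continuous:
      "\<And>\<omega> t. \<omega> \<in> space M \<Longrightarrow> 0 \<le> t \<Longrightarrow> continuous (at_right t) (\<lambda>u. N u \<omega>)"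
    and poisson_increments:
      "\<And>s t. 0 \<le> s \<Longrightarrow> s < t \<Longrightarrow>
         distr M (count_space UNIV) (\<lambda>\<omega>. N t \<omega> - N s \<omega>) = measure_pmf (poisson_pmf (rate * (t - s)))"
    and indep_increments:
      "\<And>(t :: nat \<Rightarrow> real) n. 0 \<le> t 0 \<Longrightarrow> mono t \<Longrightarrow>
         indep_vars (\<lambda>_. count_space UNIV) (\<lambda>i \<omega>. N (t (Suc i)) \<omega> - N (t i) \<omega>) {..<n}"

text \<open>
  The infimum and the minimum below range over nonempty sets for almost every \<open>\<omega>\<close>, since
  Poisson paths are almost surely unbounded; the values on the exceptional null set are
  irrelevant to all expectations.
\<close>

definition arrival_time :: "(real \<Rightarrow> 'a \<Rightarrow> nat) \<Rightarrow> nat \<Rightarrow> 'a \<Rightarrow> real" where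
  "arrival_time N n \<omega> = Inf {t. 0 \<le> t \<and> n \<le> N t \<omega>}"

definition first_nonempty_period :: "(real \<Rightarrow> 'a \<Rightarrow> nat) \<Rightarrow> real \<Rightarrow> 'a \<Rightarrow> nat" where
  "first_nonempty_period N T \<omega> = (LEAST k. 1 \<le> k \<and> 1 \<le> N (real k * T) \<omega>)"

definition revised_TP1 :: "(real \<Rightarrow> 'a \<Rightarrow> nat) \<Rightarrow> real \<Rightarrow> 'a \<Rightarrow> real" where
  "revised_TP1 N T \<omega> = real (first_nonempty_period N T \<omega>) * T"

definition revised_HP1 :: "(real \<Rightarrow> 'a \<Rightarrow> nat) \<Rightarrow> nat \<Rightarrow> real \<Rightarrow> 'a \<Rightarrow> real" where
  "revised_HP1 N q T \<omega> =
     min (arrival_time N q \<omega>) (real (first_nonempty_period N T \<omega>) * T)"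

definition expected_cycle_length :: "'a measure \<Rightarrow> ('a \<Rightarrow> real) \<Rightarrow> real" where
  "expected_cycle_length M \<tau> = (\<integral>\<omega>. \<tau> \<omega> \<partial>M)"

definition average_order_delay ::
    "'a measure \<Rightarrow> real \<Rightarrow> (real \<Rightarrow> 'a \<Rightarrow> nat) \<Rightarrow> ('a \<Rightarrow> real) \<Rightarrow> real" where
  "average_order_delay M rate N \<tau> =
     (\<integral>\<omega>. (LBINT u:{0..\<tau> \<omega>}. real (N u \<omega>)) \<partial>M) / (rate * expected_cycle_length M \<tau>)"

end

theory Submission
  imports Defs
begin

text \<open>
  Both claims compare two cycles through the expected time they spend with each load. Let \<open>L\<close> be the
  set of loads that do not trigger a release: \<open>{..<q}\<close> for revised HP1, all numbers for revised TP1.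
  At time \<open>u\<close> the cycle is still running iff \<open>N u\<close> lies in \<open>L\<close> and no order had arrived at the last
  multiple of \<open>T\<close> before \<open>u\<close>. By independence of the increments and Fubini
  (\<open>nn_integral_cycle\<close>), the expected time per cycle with load \<open>n \<in> L\<close> is \<open>load_time n x\<close> divided by
  the rate, where \<open>x\<close> is the rate times \<open>T\<close> and \<open>load_time n x\<close> is the Erlang distribution function
  \<open>1 - exp (- x) * (\<Sum>i\<le>n. x ^ i / fact i)\<close> divided by \<open>1 - exp (- x)\<close>. So the expected cycle length
  and the expected delay are, up to the factor \<open>1 / rate\<close>, the sums over \<open>n \<in> L\<close> of \<open>load_time n x\<close>
  and of \<open>n * load_time n x\<close> (\<open>cycle_integrals\<close>).

  The time at load \<open>0\<close> does not depend on the period, and the time at every other load strictly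
  increases with it (\<open>load_time_strict_mono\<close>). A policy that allows more loads therefore needs a
  shorter period for the same cycle length. It then spends less time at the positive loads below \<open>q\<close>
  and more at the loads from \<open>q\<close> on. Such a shift of a fixed total time to higher loads raises the
  delay (\<open>load_sum_comparison\<close>).
\<close>

section \<open>Load times\<close>

text \<open>
  The probability that a unit-rate Poisson process has its \<open>(n + 1)\<close>-st arrival by time \<open>x\<close>, which
  is also the expected time it spends in state \<open>n\<close> during \<open>[0, x]\<close>: the closed form is the
  antiderivative of the Poisson probability \<open>exp (- x) * x ^ n / fact n\<close> that vanishes at \<open>0\<close>.
\<close>

definition erlang_cdf :: "nat \<Rightarrow> real \<Rightarrow> real" where
  "erlang_cdf n x = 1 - exp (- x) * (\<Sum>i\<le>n. x ^ i / fact i)"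

text \<open>
  Expected time per cycle with load \<open>n\<close>, in units of the mean interarrival time, when no quantity
  limit at or below \<open>n\<close> cuts the cycle short and \<open>x\<close> is the rate times the period. One period
  contributes \<open>erlang_cdf n x\<close>; division by the probability that a period is nonempty sums the
  geometric series over the initial empty periods.
\<close>

definition load_time :: "nat \<Rightarrow> real \<Rightarrow> real" where
  "load_time n x = erlang_cdf n x / (1 - exp (- x))"

lemma erlang_cdf_0_right [simp]: "erlang_cdf n 0 = 0"
proof -
  have "(\<Sum>i\<le>n. (0::real) ^ i / fact i) = (\<Sum>i\<le>n. if i = 0 then 1 else 0)"
    by (intro sum.cong) auto
  then show ?thesis
    by (simp add: erlang_cdf_def)
qed

lemma erlang_cdf_0_left: "erlang_cdf 0 x = 1 - exp (- x)"
  by (simp add: erlang_cdf_def)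

lemma DERIV_erlang_cdf: "(erlang_cdf n has_real_derivative exp (- x) * x ^ n / fact n) (at x)"
proof (induction n)
  case 0
  show ?case
    unfolding erlang_cdf_def [abs_def] by (auto intro!: derivative_eq_intros)
next
  case (Suc n)
  have eq: "erlang_cdf (Suc n) = (\<lambda>x. erlang_cdf n x - exp (- x) * (x ^ Suc n / fact (Suc n)))"
    by (simp add: erlang_cdf_def fun_eq_iff algebra_simps)
  have "((\<lambda>x::real. x ^ Suc n / fact (Suc n)) has_real_derivative x ^ n / fact n) (at x)"
    by (rule derivative_eq_intros refl | simp add: divide_simps)+
  note * = DERIV_mult [OF DERIV_fun_exp [OF DERIV_minus [OF DERIV_ident]] this]
  show ?case
    unfolding eq by (rule DERIV_cong [OF DERIV_diff [OF Suc.IH *]]) (simp add: algebra_simps del: fact_Suc)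
qed

lemma erlang_cdf_pos:
  assumes "0 < x" shows "0 < erlang_cdf n x"
proof -
  have "erlang_cdf n 0 < erlang_cdf n x"
  proof (rule DERIV_pos_imp_increasing_open [OF assms])
    fix v :: real assume "0 < v"
    then have "0 < exp (- v) * v ^ n / fact n" by simp
    then show "\<exists>z. DERIV (erlang_cdf n) v :> z \<and> 0 < z"
      using DERIV_erlang_cdf by blast
  qed (rule DERIV_continuous_on [OF DERIV_subset [OF DERIV_erlang_cdf subset_UNIV]])
  then show ?thesis by simp
qed

text \<open>
  Both halves come from the single function \<open>erlang_cdf n v - x ^ n / fact n * erlang_cdf 0 v\<close>. Its
  derivative has the sign of \<open>v ^ n - x ^ n\<close>, so it decreases from \<open>0\<close> up to \<open>v = x\<close> and increases
  afterwards.
\<close>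

lemma erlang_cdf_less:
  assumes "1 \<le> n" "0 < x" shows "erlang_cdf n x < x ^ n / fact n * erlang_cdf 0 x"
    and "x < y \<Longrightarrow> x ^ n / fact n * (erlang_cdf 0 y - erlang_cdf 0 x) < erlang_cdf n y - erlang_cdf n x"
proof -
  define h where "h v = erlang_cdf n v - x ^ n / fact n * erlang_cdf 0 v" for v
  have D: "(h has_real_derivative exp (- v) * ((v ^ n - x ^ n) / fact n)) (at v)" for v
    unfolding h_def [abs_def]
    by (rule DERIV_cong [OF DERIV_diff [OF DERIV_erlang_cdf DERIV_cmult [OF DERIV_erlang_cdf]]])
       (simp add: field_simps)
  have cont: "continuous_on A h" for A
    using D by (intro continuous_at_imp_continuous_on) (auto intro: DERIV_isCont)
  have "h x < h 0"
  proof (rule DERIV_neg_imp_decreasing_open [OF assms(2) _ cont])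
    fix v assume "0 < v" "v < x"
    then have "v ^ n < x ^ n"
      using assms by (intro power_strict_mono) auto
    then have "exp (- v) * ((v ^ n - x ^ n) / fact n) < 0"
      by (intro mult_pos_neg divide_neg_pos) auto
    then show "\<exists>z. DERIV h v :> z \<and> z < 0"
      using D by blast
  qed
  then show "erlang_cdf n x < x ^ n / fact n * erlang_cdf 0 x"
    by (simp add: h_def)
  assume "x < y"
  have "h x < h y"
  proof (rule DERIV_pos_imp_increasing_open [OF \<open>x < y\<close> _ cont])
    fix v assume "x < v" "v < y"
    then have "x ^ n < v ^ n"
      using assms by (intro power_strict_mono) auto
    then have "0 < exp (- v) * ((v ^ n - x ^ n) / fact n)"
      by (intro mult_pos_pos divide_pos_pos) auto
    then show "\<exists>z. DERIV h v :> z \<and> 0 < z"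
      using D by blast
  qed
  then show "x ^ n / fact n * (erlang_cdf 0 y - erlang_cdf 0 x) < erlang_cdf n y - erlang_cdf n x"
    by (simp add: h_def algebra_simps)
qed

lemma load_time_0: "0 < x \<Longrightarrow> load_time 0 x = 1"
  by (simp add: load_time_def erlang_cdf_0_left)

lemma load_time_pos: "0 < x \<Longrightarrow> 0 < load_time n x"
  by (simp add: load_time_def erlang_cdf_pos)

lemma load_time_le:
  assumes "0 < x" shows "load_time n x \<le> x ^ n / fact n"
proof (cases "n = 0")
  case False
  have "0 < 1 - exp (- x)" using assms by simp
  moreover have "erlang_cdf n x < x ^ n / fact n * (1 - exp (- x))"
    using erlang_cdf_less(1) [of n x] False assms by (simp add: erlang_cdf_0_left)
  ultimately show ?thesis
    by (simp add: load_time_def pos_divide_le_eq)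
qed (use assms in \<open>simp add: load_time_0\<close>)

text \<open>
  A monotone form of l'Hopital's rule: the ratio of the derivatives of \<open>erlang_cdf n\<close> and
  \<open>erlang_cdf 0\<close> is \<open>x ^ n / fact n\<close>, which increases, hence so does the ratio of the functions.
  Load \<open>0\<close> is excluded because its time per cycle is the mean time to the first order, whatever the
  period.
\<close>

lemma load_time_strict_mono:
  assumes "1 \<le> n" "0 < x" "x < y" shows "load_time n x < load_time n y"
proof -
  let ?G = "erlang_cdf"
  have pos: "0 < ?G 0 x" "0 < ?G 0 y"
    using assms by (auto intro: erlang_cdf_pos)
  have inc: "0 < ?G 0 y - ?G 0 x"
    using assms by (simp add: erlang_cdf_0_left)
  have "?G n x * (?G 0 y - ?G 0 x) < (x ^ n / fact n * ?G 0 x) * (?G 0 y - ?G 0 x)"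
    using erlang_cdf_less(1) [OF assms(1,2)] inc by (rule mult_strict_right_mono)
  also have "\<dots> = (x ^ n / fact n * (?G 0 y - ?G 0 x)) * ?G 0 x"
    by simp
  also have "\<dots> < (?G n y - ?G n x) * ?G 0 x"
    using erlang_cdf_less(2) [OF assms] pos by (intro mult_strict_right_mono)
  finally have "?G n x * ?G 0 y < ?G n y * ?G 0 x"
    by (simp add: algebra_simps)
  then show ?thesis
    using pos by (simp add: load_time_def divide_less_eq less_divide_eq flip: erlang_cdf_0_left)
qed

lemma summable_load_time:
  assumes "0 < x"
  shows "summable (\<lambda>n. indicator L n * load_time n x)"
    and "summable (\<lambda>n. indicator L n * (real n * load_time n x))"
proof -
  have *: "0 \<le> load_time n x" for n
    using load_time_pos [OF assms] less_imp_le by blast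
  have s: "summable (\<lambda>n. x ^ n / fact n)"
    using summable_exp [of x] by (simp add: field_simps)
  show "summable (\<lambda>n. indicator L n * load_time n x)"
    using load_time_le [OF assms] *
    by (intro summable_comparison_test' [OF s, of 0]) (auto simp: indicator_def assms less_imp_le)
  have "summable (\<lambda>n. real (Suc n) * (x ^ Suc n / fact (Suc n)))"
    using summable_mult [OF s, of x] by (simp add: field_simps del: of_nat_Suc)
  then have s': "summable (\<lambda>n. real n * (x ^ n / fact n))"
    by (subst (asm) summable_Suc_iff)
  show "summable (\<lambda>n. indicator L n * (real n * load_time n x))"
    using mult_left_mono [OF load_time_le [OF assms], of "real n" n for n] *
    by (intro summable_comparison_test' [OF s', of 0]) (auto simp: indicator_def assms less_imp_le)
qed

text \<open>
  The single-crossing argument. Allowing more loads at equal total time forces \<open>y < x\<close>, so every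
  positive load below \<open>q\<close> loses time and the loads from \<open>q\<close> on gain it. Weighting the change by
  \<open>n - q\<close> makes every term nonnegative, and subtracting \<open>q\<close> times the (vanishing) change of total
  time does not alter the sum. For \<open>q = 1\<close> the totals cannot agree: the smaller policy has total
  exactly \<open>1\<close>, and the larger one exceeds it.
\<close>

lemma load_sum_comparison:
  assumes q: "1 \<le> q" "{..q} \<subseteq> L" and x: "0 < x" and y: "0 < y"
    and eq: "(\<Sum>n<q. load_time n x) = (\<Sum>n. indicator L n * load_time n y)"
  shows "(\<Sum>n<q. real n * load_time n x) < (\<Sum>n. indicator L n * (real n * load_time n y))"
proof -
  note pos = load_time_pos [OF y]
  have tail: "(\<Sum>n\<le>q. load_time n y) \<le> (\<Sum>n. indicator L n * load_time n y)"
  proof -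
    have "(\<Sum>n\<le>q. load_time n y) = (\<Sum>n\<le>q. indicator L n * load_time n y)"
      using q by (intro sum.cong) (auto simp: indicator_def)
    also have "\<dots> \<le> (\<Sum>n. indicator L n * load_time n y)"
      using pos by (intro sum_le_suminf summable_load_time y) (auto simp: less_imp_le)
    finally show ?thesis .
  qed
  have less: "(\<Sum>n<q. load_time n y) < (\<Sum>n<q. load_time n x)"
    using tail pos [of q] unfolding eq lessThan_Suc_atMost [symmetric] by simp
  have "y < x"
  proof (rule ccontr)
    assume "\<not> y < x"
    then have "load_time n x \<le> load_time n y" for n
      using load_time_strict_mono [of n x y] x y load_time_0 [of x] load_time_0 [of y]
      by (cases "n = 0"; cases "x = y") auto
    then have "(\<Sum>n<q. load_time n x) \<le> (\<Sum>n<q. load_time n y)"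
      by (intro sum_mono)
    with less show False by simp
  qed
  have mono: "load_time n y \<le> load_time n x" for n
    using load_time_strict_mono [of n y x] x y \<open>y < x\<close> load_time_0 [of x] load_time_0 [of y]
    by (cases "n = 0") auto
  have "q \<noteq> 1"
    using less x y by (auto simp: load_time_0)
  then have "1 < q" using q by simp
  have "(\<Sum>n<q. (real q - real n) * load_time n y) < (\<Sum>n<q. (real q - real n) * load_time n x)"
    using mono load_time_strict_mono [of 1 y x] x y \<open>y < x\<close> \<open>1 < q\<close>
    by (intro sum_strict_mono_ex1) (auto intro!: mult_left_mono bexI [of _ 1])
  also have "\<dots> = real q * (\<Sum>n<q. load_time n x) - (\<Sum>n<q. real n * load_time n x)"
    by (simp add: sum_subtractf left_diff_distrib sum_distrib_left)
  finally have 1: "(\<Sum>n<q. real n * load_time n x) + (\<Sum>n<q. (real q - real n) * load_time n y)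
     < real q * (\<Sum>n. indicator L n * load_time n y)"
    by (simp add: eq)
  note s = summable_load_time [OF y, of L]
  have "(\<Sum>n<q. (real n - real q) * load_time n y)
     = (\<Sum>n<q. indicator L n * (real n * load_time n y) - real q * (indicator L n * load_time n y))"
    using q by (intro sum.cong) (auto simp: indicator_def left_diff_distrib subset_iff)
  also have "\<dots> \<le> (\<Sum>n. indicator L n * (real n * load_time n y) - real q * (indicator L n * load_time n y))"
    using pos by (intro sum_le_suminf summable_diff summable_mult s)
      (auto simp: indicator_def less_imp_le)
  also have "\<dots> = (\<Sum>n. indicator L n * (real n * load_time n y))
      - real q * (\<Sum>n. indicator L n * load_time n y)"
    by (simp add: suminf_diff [symmetric] suminf_mult summable_mult s)
  finally have 2: "(\<Sum>n<q. (real n - real q) * load_time n y) \<le> \<dots>" .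
  have 3: "(\<Sum>n<q. (real n - real q) * load_time n y) = - (\<Sum>n<q. (real q - real n) * load_time n y)"
    by (simp add: sum_negf [symmetric] algebra_simps)
  show ?thesis
    using 1 2 3 by simp
qed

section \<open>Distribution and regularity of the order process\<close>

definition poisson_density :: "nat \<Rightarrow> real \<Rightarrow> real" where
  "poisson_density n x = exp (- x) * x ^ n / fact n"

lemma (in poisson_process) prob_increment:
  assumes "0 \<le> s" "s \<le> t"
  shows "prob {\<omega> \<in> space M. N t \<omega> - N s \<omega> = n} = poisson_density n (rate * (t - s))"
proof (cases "s = t")
  case True
  then show ?thesis
    by (cases "n = 0") (auto simp: poisson_density_def prob_space)
next
  case False
  then have "s < t" using assms by simp
  have [measurable]: "N s \<in> measurable M (count_space UNIV)" "N t \<in> measurable M (count_space UNIV)"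
    using assms by (auto intro: measurable_N)
  have "(\<lambda>\<omega>. N t \<omega> - N s \<omega>) \<in> measurable M (count_space UNIV)"
    by measurable
  then have "prob {\<omega> \<in> space M. N t \<omega> - N s \<omega> = n}
      = measure (distr M (count_space UNIV) (\<lambda>\<omega>. N t \<omega> - N s \<omega>)) {n}"
    by (subst measure_distr) (auto intro!: arg_cong [where f = "measure M"])
  also have "\<dots> = pmf (poisson_pmf (rate * (t - s))) n"
    using poisson_increments [OF assms(1) \<open>s < t\<close>] by (simp add: pmf.rep_eq)
  also have "\<dots> = poisson_density n (rate * (t - s))"
    using \<open>s < t\<close> rate_pos by (subst pmf_poisson) (auto simp: poisson_density_def)
  finally show ?thesis .
qed

text \<open>
  The only place where independence of increments enters: given no order up to \<open>s\<close>, the load at \<open>t\<close>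
  is the increment over \<open>(s, t]\<close>.
\<close>

lemma (in poisson_process) prob_empty_then_load:
  assumes "0 \<le> s" "s \<le> t"
  shows "prob {\<omega> \<in> space M. N s \<omega> = 0 \<and> N t \<omega> = n}
    = exp (- (rate * s)) * poisson_density n (rate * (t - s))"
proof -
  define r :: "nat \<Rightarrow> real" where "r i = (if i = 0 then 0 else if i = 1 then s else t)" for i
  define A :: "nat \<Rightarrow> nat set" where "A i = (if i = 0 then {0} else {n})" for i
  have "mono r"
    using assms unfolding mono_def r_def by auto
  then have ind: "indep_vars (\<lambda>_. count_space UNIV) (\<lambda>i \<omega>. N (r (Suc i)) \<omega> - N (r i) \<omega>) {..<2}"
    by (intro indep_increments [OF _ \<open>mono r\<close>]) (simp add: r_def)
  have two: "{..<2} = {0, 1::nat}" by auto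
  have "{\<omega> \<in> space M. N s \<omega> = 0 \<and> N t \<omega> = n}
      = (\<Inter>i\<in>{..<2}. (\<lambda>\<omega>. N (r (Suc i)) \<omega> - N (r i) \<omega>) -` A i \<inter> space M)"
    using N_zero by (auto simp: two r_def A_def)
  also have "prob \<dots> = (\<Prod>i<2. prob ((\<lambda>\<omega>. N (r (Suc i)) \<omega> - N (r i) \<omega>) -` A i \<inter> space M))"
    by (rule indep_varsD_finite [OF ind]) (simp_all add: two)
  also have "\<dots> = prob {\<omega> \<in> space M. N s \<omega> - N 0 \<omega> = 0} * prob {\<omega> \<in> space M. N t \<omega> - N s \<omega> = n}"
    unfolding two by (simp add: r_def A_def vimage_def Int_def conj_commute)
  also have "\<dots> = exp (- (rate * s)) * poisson_density n (rate * (t - s))"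
    using assms by (simp only: prob_increment order_refl) (simp add: poisson_density_def)
  finally show ?thesis .
qed

text \<open>
  Ensures that the release times are determined by a nonempty infimum and an attained minimum: the
  probability of a load below \<open>n\<close> at time \<open>j\<close> vanishes as \<open>j\<close> grows.
\<close>

lemma (in poisson_process) AE_unbounded: "AE \<omega> in M. \<forall>n. \<exists>j::nat. n \<le> N (real j) \<omega>"
proof -
  note [measurable] = measurable_N
  have "AE \<omega> in M. \<exists>j::nat. n \<le> N (real j) \<omega>" for n
  proof -
    let ?S = "{\<omega> \<in> space M. \<forall>j::nat. N (real j) \<omega> < n}"
    have S [measurable]: "?S \<in> sets M" by measurable
    have bound: "prob ?S \<le> (\<Sum>i<n. poisson_density i (rate * real j))" for j :: nat
    proof -
      have "prob ?S \<le> prob (\<Union>i<n. {\<omega> \<in> space M. N (real j) \<omega> - N 0 \<omega> = i})"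
        using N_zero by (intro finite_measure_mono) auto
      also have "\<dots> \<le> (\<Sum>i<n. prob {\<omega> \<in> space M. N (real j) \<omega> - N 0 \<omega> = i})"
        by (intro finite_measure_subadditive_finite) auto
      finally show ?thesis by (simp add: prob_increment)
    qed
    have "(\<lambda>j. \<Sum>i<n. poisson_density i (rate * real j)) \<longlonglongrightarrow> (\<Sum>i<n. 0)"
    proof (intro tendsto_sum)
      fix i
      have lim: "((\<lambda>x::real. x ^ i / exp x * inverse (fact i)) \<longlongrightarrow> 0) at_top"
        by (rule tendsto_mult_left_zero [OF tendsto_power_div_exp_0])
      have "filterlim (\<lambda>j. rate * real j) at_top sequentially"
        by (rule filterlim_tendsto_pos_mult_at_top [OF tendsto_const rate_pos filterlim_real_sequentially])
      from filterlim_compose [OF lim this]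
      show "(\<lambda>j. poisson_density i (rate * real j)) \<longlonglongrightarrow> 0"
        by (simp add: poisson_density_def exp_minus field_simps)
    qed
    then have "prob ?S \<le> 0"
      using bound by (intro LIMSEQ_le_const) auto
    then have "prob ?S = 0" by (simp add: measure_le_0_iff)
    then have "AE \<omega> in M. \<omega> \<notin> ?S"
      using S prob_eq_0 by blast
    then show ?thesis by (rule AE_mp) (auto intro!: AE_I2 simp: not_less)
  qed
  then show ?thesis by (simp add: AE_all_countable)
qed

text \<open>
  Joint measurability in outcome and time, needed to interchange expectation and time integral;
  it rests on right-continuity of the paths. The clamp \<open>max 0 u\<close> is there because nothing is known
  about the process at negative times.
\<close>

lemma (in poisson_process) measurable_path [measurable]:
  "(\<lambda>(\<omega>, u). N (max 0 u) \<omega>) \<in> measurable (M \<Otimes>\<^sub>M lborel) (count_space UNIV)"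
proof -
  \<comment> \<open>\<open>g j u / (j + 1)\<close> lies strictly to the right of \<open>max 0 u\<close>, tends to it, and takes countably
    many values.\<close>
  define g :: "nat \<Rightarrow> real \<Rightarrow> nat" where "g j u = nat (\<lfloor>max 0 u * real (Suc j)\<rfloor> + 1)" for j u
  have g: "g j \<in> measurable borel (count_space UNIV)" for j
    unfolding g_def [abs_def] by measurable
  have step: "(\<lambda>x. N (real (g j (snd x)) / real (Suc j)) (fst x))
      \<in> measurable (M \<Otimes>\<^sub>M lborel) (count_space UNIV)" for j
    by (rule measurable_compose_countable [where f = "\<lambda>i x. N (real i / real (Suc j)) (fst x)"])
       (auto intro!: measurable_compose [OF measurable_fst measurable_N] measurable_compose [OF measurable_snd]
          g simp: measurable_lborel2)
  have lim: "(\<lambda>j. real (N (real (g j u) / real (Suc j)) \<omega>)) \<longlonglongrightarrow> real (N (max 0 u) \<omega>)"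
    if "\<omega> \<in> space M" for \<omega> u
  proof -
    have gr: "max 0 u < real (g j u) / real (Suc j)"
      and le: "real (g j u) / real (Suc j) \<le> max 0 u + 1 / real (Suc j)" for j
    proof -
      define w where "w = max 0 u * real (Suc j)"
      have pos: "0 < real (Suc j)" by simp
      have "0 \<le> w" by (simp add: w_def)
      then have "0 \<le> \<lfloor>w\<rfloor>" by simp
      then have eq: "real (g j u) = real_of_int \<lfloor>w\<rfloor> + 1"
        unfolding g_def w_def by simp
      have w: "w < real (g j u)" "real (g j u) \<le> w + 1"
        unfolding eq by linarith+
      show "max 0 u < real (g j u) / real (Suc j)"
        using w(1) unfolding w_def by (simp only: pos_less_divide_eq [OF pos])
      have "real (g j u) / real (Suc j) \<le> (w + 1) / real (Suc j)"
        using w(2) by (intro divide_right_mono) simp_all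
      also have "\<dots> = max 0 u + 1 / real (Suc j)"
        using pos by (simp only: w_def add_divide_distrib) simp
      finally show "real (g j u) / real (Suc j) \<le> max 0 u + 1 / real (Suc j)" .
    qed
    have "(\<lambda>j. max 0 u + 1 / real (Suc j)) \<longlonglongrightarrow> max 0 u"
      using LIMSEQ_inverse_real_of_nat_add [of "max 0 u"] by (simp only: inverse_eq_divide)
    then have "(\<lambda>j. real (g j u) / real (Suc j)) \<longlonglongrightarrow> max 0 u"
      by (rule tendsto_sandwich [OF always_eventually always_eventually tendsto_const, rotated 2])
         (use gr le in \<open>blast intro: less_imp_le\<close>)+
    then have "filterlim (\<lambda>j. real (g j u) / real (Suc j)) (at_right (max 0 u)) sequentially"
      by (rule tendsto_imp_filterlim_at_right) (rule always_eventually, use gr in blast)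
    moreover have "((\<lambda>v. real (N v \<omega>)) \<longlongrightarrow> real (N (max 0 u) \<omega>)) (at_right (max 0 u))"
    proof (rule tendsto_eventually)
      have "((\<lambda>v. N v \<omega>) \<longlongrightarrow> N (max 0 u) \<omega>) (at_right (max 0 u))"
        using N_right_continuous [OF that, of "max 0 u"] by (simp add: continuous_within)
      then show "\<forall>\<^sub>F v in at_right (max 0 u). real (N v \<omega>) = real (N (max 0 u) \<omega>)"
        by (simp only: tendsto_discrete of_nat_eq_iff)
    qed
    ultimately show ?thesis
      by (rule filterlim_compose [rotated])
  qed
  have "(\<lambda>x. real (N (max 0 (snd x)) (fst x))) \<in> borel_measurable (M \<Otimes>\<^sub>M lborel)"
  proof (rule borel_measurable_LIMSEQ_real)
    fix j
    show "(\<lambda>x. real (N (real (g j (snd x)) / real (Suc j)) (fst x))) \<in> borel_measurable (M \<Otimes>\<^sub>M lborel)"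
      by (rule measurable_compose [OF step]) simp
  qed (rule lim, simp add: space_pair_measure mem_Times_iff)
  then have "(\<lambda>x. nat \<lfloor>real (N (max 0 (snd x)) (fst x))\<rfloor>) \<in> measurable (M \<Otimes>\<^sub>M lborel) (count_space UNIV)"
    by measurable
  then show ?thesis by (simp add: split_beta')
qed

section \<open>Release times\<close>

text \<open>
  Right-continuity makes the infimum an attained one, so that \<open>u < \<tau>\<^sub>q\<close> is an event about the load at
  the single time \<open>u\<close>.
\<close>

lemma (in poisson_process) less_arrival_time_iff:
  assumes "\<omega> \<in> space M" "\<exists>j::nat. q \<le> N (real j) \<omega>" "0 \<le> u"
  shows "u < arrival_time N q \<omega> \<longleftrightarrow> N u \<omega> < q"
proof
  let ?S = "{t. 0 \<le> t \<and> q \<le> N t \<omega>}"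
  have ne: "?S \<noteq> {}" and bdd: "bdd_below ?S"
    using assms of_nat_0_le_iff by (blast, auto intro: bdd_belowI [of _ 0])
  show "N u \<omega> < q" if "u < arrival_time N q \<omega>"
  proof (rule ccontr)
    assume "\<not> N u \<omega> < q"
    then have "Inf ?S \<le> u"
      using assms by (intro cInf_lower bdd) auto
    with that show False by (simp add: arrival_time_def)
  qed
  assume less: "N u \<omega> < q"
  have "((\<lambda>v. N v \<omega>) \<longlongrightarrow> N u \<omega>) (at_right u)"
    using N_right_continuous [OF assms(1,3)] by (simp add: continuous_within)
  then have "eventually (\<lambda>v. N v \<omega> = N u \<omega>) (at_right u)"
    by (simp add: tendsto_discrete)
  then obtain b where b: "u < b" "\<And>v. u < v \<Longrightarrow> v < b \<Longrightarrow> N v \<omega> = N u \<omega>"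
    unfolding eventually_at_right_field by auto
  have "b \<le> Inf ?S"
  proof (rule cInf_greatest [OF ne])
    fix t assume t: "t \<in> ?S"
    show "b \<le> t"
    proof (rule ccontr)
      assume "\<not> b \<le> t"
      then have "N t \<omega> \<le> N ((max u t + b) / 2) \<omega>"
        using t b(1) by (intro N_mono [OF assms(1)]) (auto simp: max_def)
      also have "\<dots> = N u \<omega>"
        using \<open>\<not> b \<le> t\<close> b(1) by (intro b(2)) (auto simp: max_def)
      finally show False using t less by auto
    qed
  qed
  with b(1) show "u < arrival_time N q \<omega>" by (simp add: arrival_time_def)
qed

text \<open>
  The clearing clock is still running at \<open>u\<close> precisely when the last multiple of \<open>T\<close> up to \<open>u\<close> found
  no order; earlier multiples are then empty as well, because the load only grows.
\<close>

lemma (in poisson_process) less_first_nonempty_period_iff: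
  assumes "\<omega> \<in> space M" "\<exists>j::nat. 1 \<le> N (real j) \<omega>" "0 < T" "0 \<le> u"
  shows "u < real (first_nonempty_period N T \<omega>) * T \<longleftrightarrow> N (real (nat \<lfloor>u / T\<rfloor>) * T) \<omega> = 0"
proof -
  define K where "K = first_nonempty_period N T \<omega>"
  define k where "k = nat \<lfloor>u / T\<rfloor>"
  have kT: "real k * T \<le> u" "u < real (Suc k) * T"
  proof -
    have "real k \<le> u / T" "u / T < real (Suc k)"
      using assms unfolding k_def by (simp_all add: of_nat_nat) linarith
    then show "real k * T \<le> u" "u < real (Suc k) * T"
      using assms by (simp_all add: pos_le_divide_eq pos_divide_less_eq)
  qed
  obtain j :: nat where j: "1 \<le> N (real j) \<omega>" using assms by auto
  obtain m :: nat where m: "real j / T < real m" using reals_Archimedean2 by blast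
  then have "N (real j) \<omega> \<le> N (real m * T) \<omega>"
    using assms by (intro N_mono) (auto simp: pos_divide_less_eq)
  moreover have "0 \<le> real j / T" using assms by simp
  with m have "m \<noteq> 0" by (intro notI) simp
  ultimately have ex: "1 \<le> m \<and> 1 \<le> N (real m * T) \<omega>"
    using j by auto
  have K: "1 \<le> K \<and> 1 \<le> N (real K * T) \<omega>"
    unfolding K_def first_nonempty_period_def by (rule LeastI, rule ex)
  have least: "N (real i * T) \<omega> = 0" if "i < K" for i
    using not_less_Least [OF that [unfolded K_def first_nonempty_period_def]] N_zero assms
    by (cases "i = 0") auto
  have "u < real K * T \<longleftrightarrow> N (real k * T) \<omega> = 0"
  proof
    assume "u < real K * T"
    with kT have "real k * T < real K * T" by simp
    then show "N (real k * T) \<omega> = 0"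
      using assms least by simp
  next
    assume zero: "N (real k * T) \<omega> = 0"
    have "k < K"
    proof (rule ccontr)
      assume "\<not> k < K"
      then have "N (real K * T) \<omega> \<le> N (real k * T) \<omega>"
        using assms by (intro N_mono) auto
      with zero K show False by simp
    qed
    then have "real (Suc k) * T \<le> real K * T"
      using assms by (intro mult_right_mono) auto
    with kT show "u < real K * T" by simp
  qed
  then show ?thesis by (simp add: K_def k_def)
qed

lemma (in poisson_process) measurable_TP1:
  assumes "0 < T" shows "revised_TP1 N T \<in> borel_measurable M"
proof -
  have [measurable]: "N (real k * T) \<in> measurable M (count_space UNIV)" for k
    using assms by (intro measurable_N) simp
  show ?thesis
    unfolding revised_TP1_def [abs_def] first_nonempty_period_def by measurable
qed

text \<open>
  The measure space need not be complete, so almost sure information is not enough here: on the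
  null set of paths that never reach \<open>q\<close> the arrival time is the constant \<open>Inf {}\<close>, which keeps it
  measurable.
\<close>

lemma (in poisson_process) measurable_arrival_time:
  "arrival_time N q \<in> borel_measurable M"
proof (rule borel_measurableI_greater)
  fix y
  have [measurable]: "N (real j) \<in> measurable M (count_space UNIV)" for j
    by (rule measurable_N) simp
  have [measurable]: "N (max 0 y) \<in> measurable M (count_space UNIV)"
    by (rule measurable_N) simp
  define A where "A = {\<omega> \<in> space M. \<exists>j::nat. q \<le> N (real j) \<omega>}"
  have A: "A \<in> sets M" unfolding A_def by measurable
  have outside: "arrival_time N q \<omega> = Inf {}" if "\<omega> \<in> space M - A" for \<omega>
  proof -
    have "\<not> q \<le> N t \<omega>" if "0 \<le> t" for t
    proof -
      obtain j :: nat where "t \<le> real j" using real_arch_simple by blast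
      then have "N t \<omega> \<le> N (real j) \<omega>"
        using that \<open>\<omega> \<in> space M - A\<close> by (intro N_mono) auto
      then show ?thesis using \<open>\<omega> \<in> space M - A\<close> by (auto simp: A_def not_le intro: le_less_trans)
    qed
    then have empty: "{t. 0 \<le> t \<and> q \<le> N t \<omega>} = {}" by auto
    show ?thesis unfolding arrival_time_def empty ..
  qed
  have inside: "y < arrival_time N q \<omega> \<longleftrightarrow> y < 0 \<or> N (max 0 y) \<omega> < q" if "\<omega> \<in> A" for \<omega>
  proof (cases "y < 0")
    case True
    have "0 \<le> arrival_time N q \<omega>"
      using that of_nat_0_le_iff unfolding arrival_time_def A_def by (intro cInf_greatest) blast+
    with True show ?thesis by simp
  next
    case False
    then show ?thesis using less_arrival_time_iff [of \<omega> q y] that by (simp add: max_def A_def)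
  qed
  have "{\<omega> \<in> space M. y < arrival_time N q \<omega>}
      = {\<omega> \<in> A. y < 0 \<or> N (max 0 y) \<omega> < q} \<union> {\<omega> \<in> space M - A. y < Inf {}}"
  proof (rule set_eqI)
    fix \<omega>
    show "\<omega> \<in> {\<omega> \<in> space M. y < arrival_time N q \<omega>}
      \<longleftrightarrow> \<omega> \<in> {\<omega> \<in> A. y < 0 \<or> N (max 0 y) \<omega> < q} \<union> {\<omega> \<in> space M - A. y < Inf {}}"
      using sets.sets_into_space [OF A] inside [of \<omega>] outside [of \<omega>] by (cases "\<omega> \<in> A") auto
  qed
  also have "{\<omega> \<in> A. y < 0 \<or> N (max 0 y) \<omega> < q}
      = A \<inter> {\<omega> \<in> space M. y < 0 \<or> N (max 0 y) \<omega> < q}"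
    using sets.sets_into_space [OF A] by auto
  also have "{\<omega> \<in> space M - A. y < Inf {}} = (if y < Inf {} then space M - A else {})"
    by auto
  finally have eq: "{\<omega> \<in> space M. y < arrival_time N q \<omega>}
    = A \<inter> {\<omega> \<in> space M. y < 0 \<or> N (max 0 y) \<omega> < q} \<union> (if y < Inf {} then space M - A else {})" .
  have "{\<omega> \<in> space M. y < 0 \<or> N (max 0 y) \<omega> < q} \<in> sets M"
    by measurable
  then show "{\<omega> \<in> space M. y < arrival_time N q \<omega>} \<in> sets M"
    unfolding eq using A by (intro sets.Un sets.Int) (auto split: if_split)
qed

lemma (in poisson_process) measurable_HP1:
  assumes "0 < T" shows "revised_HP1 N q T \<in> borel_measurable M"
  using measurable_TP1 [OF assms] measurable_arrival_time [of q]
  unfolding revised_HP1_def [abs_def] revised_TP1_def [abs_def]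
  by (intro borel_measurable_min)

section \<open>Expected rewards of a cycle\<close>

text \<open>
  The probability that the clock is still running at time \<open>u\<close> with load \<open>n\<close>, apart from the multiples
  of \<open>T\<close>. It is written as a series over periods, of which a single one contributes, so that its
  integral is a geometric series. Closed periods overlap only in a null set and fit the fundamental
  theorem of calculus.
\<close>

definition occupancy :: "real \<Rightarrow> real \<Rightarrow> nat \<Rightarrow> real \<Rightarrow> ennreal" where
  "occupancy r T n u =
     (\<Sum>k. ennreal (exp (- (r * (real k * T))) * poisson_density n (r * (u - real k * T)))
           * indicator {real k * T..real (Suc k) * T} u)"

lemma borel_measurable_poisson_density [measurable]: "poisson_density n \<in> borel_measurable borel"
  unfolding poisson_density_def [abs_def] by measurable

lemma borel_measurable_occupancy [measurable]: "occupancy r T n \<in> borel_measurable borel"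
  unfolding occupancy_def [abs_def] by measurable

lemma poisson_density_nonneg: "0 \<le> x \<Longrightarrow> 0 \<le> poisson_density n x"
  by (simp add: poisson_density_def)

lemma nn_integral_occupancy:
  assumes "0 < r" "0 < T"
  shows "(\<integral>\<^sup>+u. occupancy r T n u \<partial>lborel) = ennreal (load_time n (r * T) / r)"
proof -
  have block: "(\<integral>\<^sup>+u. ennreal (exp (- (r * (real k * T))) * poisson_density n (r * (u - real k * T)))
           * indicator {real k * T..real (Suc k) * T} u \<partial>lborel)
      = ennreal (exp (- (r * T)) ^ k * (erlang_cdf n (r * T) / r))" for k
  proof -
    define F where "F u = exp (- (r * (real k * T))) * (erlang_cdf n (r * (u - real k * T)) / r)" for u
    have "(F has_real_derivative exp (- (r * (real k * T))) * poisson_density n (r * (u - real k * T))) (at u)" for u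
    proof -
      have "((\<lambda>u. r * (u - real k * T)) has_real_derivative r) (at u)"
        by (auto intro!: derivative_eq_intros)
      note D = DERIV_chain2 [OF DERIV_erlang_cdf [of n] this]
      show ?thesis
        unfolding F_def [abs_def]
        by (rule DERIV_cong [OF DERIV_cmult [OF DERIV_cdivide [OF D]]])
           (use assms in \<open>simp add: poisson_density_def\<close>)
    qed
    then have "(\<integral>\<^sup>+u. ennreal (exp (- (r * (real k * T))) * poisson_density n (r * (u - real k * T)))
           * indicator {real k * T..real (Suc k) * T} u \<partial>lborel)
        = ennreal (F (real (Suc k) * T) - F (real k * T))"
      using assms
      by (intro nn_integral_FTC_Icc)
         (auto intro!: mult_nonneg_nonneg poisson_density_nonneg DERIV_subset )
    also have "F (real (Suc k) * T) - F (real k * T) = exp (- (r * T)) ^ k * (erlang_cdf n (r * T) / r)"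
    proof -
      have "real (Suc k) * T - real k * T = T" by (simp add: distrib_right)
      moreover have "exp (- (r * (real k * T))) = exp (- (r * T)) ^ k"
        by (simp add: exp_of_nat_mult [symmetric] mult_ac)
      ultimately show ?thesis by (simp only: F_def) simp
    qed
    finally show ?thesis .
  qed
  have "exp (- (r * T)) < 1" using assms by simp
  then have geom: "(\<lambda>k. exp (- (r * T)) ^ k) sums (1 / (1 - exp (- (r * T))))"
    by (intro geometric_sums) simp
  have "(\<integral>\<^sup>+u. occupancy r T n u \<partial>lborel)
      = (\<Sum>k. ennreal (exp (- (r * T)) ^ k * (erlang_cdf n (r * T) / r)))"
    unfolding occupancy_def
    by (subst nn_integral_suminf) (measurable, simp only: block)
  also have "\<dots> = ennreal (1 / (1 - exp (- (r * T))) * (erlang_cdf n (r * T) / r))"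
    using assms erlang_cdf_pos [of "r * T" n] by (intro suminf_ennreal_eq sums_mult2 geom) simp
  also have "\<dots> = ennreal (load_time n (r * T) / r)"
    by (simp add: load_time_def)
  finally show ?thesis .
qed

lemma (in poisson_process) emeasure_occupancy:
  assumes "0 < T" "0 \<le> u" "\<And>k::nat. u \<noteq> real k * T"
  shows "emeasure M {\<omega> \<in> space M. N (real (nat \<lfloor>u / T\<rfloor>) * T) \<omega> = 0 \<and> N u \<omega> = n} = occupancy rate T n u"
proof -
  define k where "k = nat \<lfloor>u / T\<rfloor>"
  have k: "real k * T \<le> u" "u < real (Suc k) * T"
  proof -
    have "real k \<le> u / T" "u / T < real (Suc k)"
      using assms unfolding k_def by (simp_all add: of_nat_nat) linarith
    then show "real k * T \<le> u" "u < real (Suc k) * T"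
      using assms by (simp_all add: pos_le_divide_eq pos_divide_less_eq)
  qed
  have other: "indicator {real i * T..real (Suc i) * T} u = (0::ennreal)" if "i \<noteq> k" for i
  proof (cases "i < k")
    case True
    then have "real (Suc i) * T \<le> real k * T"
      using assms by (intro mult_right_mono) auto
    with k have "real (Suc i) * T \<le> u" by simp
    with assms(3) [of "Suc i"] have "real (Suc i) * T < u" by simp
    then show ?thesis by simp
  next
    case False
    then have "real (Suc k) * T \<le> real i * T"
      using assms that by (intro mult_right_mono) auto
    with k show ?thesis by simp
  qed
  have "occupancy rate T n u = (\<Sum>i\<in>{k}. ennreal (exp (- (rate * (real i * T))) * poisson_density n (rate * (u - real i * T)))
           * indicator {real i * T..real (Suc i) * T} u)"
    unfolding occupancy_def by (rule suminf_finite) (use other in auto)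
  also have "\<dots> = ennreal (prob {\<omega> \<in> space M. N (real k * T) \<omega> = 0 \<and> N u \<omega> = n})"
    using k assms by (subst prob_empty_then_load) auto
  finally show ?thesis by (simp add: k_def emeasure_eq_measure)
qed

text \<open>
  Fubini reduces the expected reward of a cycle to the probability of each load at each fixed time.
  Hence no distribution of the release time, and no strong Markov property at the first arrival, has
  to be worked out. Taking \<open>L = {..<q}\<close> gives revised HP1 and \<open>L = UNIV\<close> revised TP1.
\<close>

lemma (in poisson_process) nn_integral_cycle:
  fixes c :: "nat \<Rightarrow> ennreal"
  assumes T: "0 < T" and [measurable]: "\<tau> \<in> borel_measurable M"
    and \<tau>: "AE \<omega> in M. \<forall>u\<ge>0. u < \<tau> \<omega> \<longleftrightarrow> N u \<omega> \<in> L \<and> N (real (nat \<lfloor>u / T\<rfloor>) * T) \<omega> = 0"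
  shows "(\<integral>\<^sup>+\<omega>. \<integral>\<^sup>+u. c (N u \<omega>) * indicator {0..<\<tau> \<omega>} u \<partial>lborel \<partial>M)
    = (\<Sum>n. c n * indicator L n * ennreal (load_time n (rate * T) / rate))"
proof -
  interpret pair_sigma_finite M lborel ..
  define h where "h \<omega> u = c (N (max 0 u) \<omega>) * indicator {0..<\<tau> \<omega>} u" for \<omega> u
  have "(\<lambda>x. c (case x of (\<omega>, u) \<Rightarrow> N (max 0 u) \<omega>)) \<in> borel_measurable (M \<Otimes>\<^sub>M lborel)"
    by (rule measurable_compose [OF measurable_path]) simp
  then have [measurable]: "(\<lambda>x. c (N (max 0 (snd x)) (fst x))) \<in> borel_measurable (M \<Otimes>\<^sub>M lborel)"
    by (simp add: split_beta')
  have "(\<lambda>x. c (N (max 0 (snd x)) (fst x)) * (if 0 \<le> snd x \<and> snd x < \<tau> (fst x) then 1 else 0))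
      \<in> borel_measurable (M \<Otimes>\<^sub>M lborel)"
    by measurable
  then have h [measurable]: "case_prod h \<in> borel_measurable (M \<Otimes>\<^sub>M lborel)"
    by (simp add: h_def split_beta' indicator_def)
  have inner: "(\<integral>\<^sup>+\<omega>. h \<omega> u \<partial>M) = (\<Sum>n. c n * indicator L n * occupancy rate T n u)"
    if u: "\<And>k::nat. u \<noteq> real k * T" for u
  proof (cases "0 \<le> u")
    case True
    let ?E = "\<lambda>n. {\<omega> \<in> space M. N (real (nat \<lfloor>u / T\<rfloor>) * T) \<omega> = 0 \<and> N u \<omega> = n}"
    have [measurable]: "N (real (nat \<lfloor>u / T\<rfloor>) * T) \<in> measurable M (count_space UNIV)"
      "N u \<in> measurable M (count_space UNIV)"
      using T True by (auto intro!: measurable_N)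
    have E: "?E n \<in> sets M" for n by measurable
    have "(\<integral>\<^sup>+\<omega>. h \<omega> u \<partial>M) = (\<integral>\<^sup>+\<omega>. (\<Sum>n. c n * indicator L n * indicator (?E n) \<omega>) \<partial>M)"
    proof (rule nn_integral_cong_AE)
      show "AE \<omega> in M. h \<omega> u = (\<Sum>n. c n * indicator L n * indicator (?E n) \<omega>)"
        using \<tau> AE_space
      proof eventually_elim
        case (elim \<omega>)
        have "(\<Sum>n. c n * indicator L n * indicator (?E n) \<omega>)
            = (\<Sum>n\<in>{N u \<omega>}. c n * indicator L n * indicator (?E n) \<omega>)"
          by (rule suminf_finite) auto
        then show ?case
          using elim True by (auto simp: h_def indicator_def max_def)
      qed
    qed
    also have "\<dots> = (\<Sum>n. c n * indicator L n * emeasure M (?E n))"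
      using E by (subst nn_integral_suminf) (auto simp: nn_integral_cmult)
    also have "\<dots> = (\<Sum>n. c n * indicator L n * occupancy rate T n u)"
      by (simp only: emeasure_occupancy [OF T True u])
    finally show ?thesis .
  next
    case False
    have "u < real k * T" for k
      using False T by (intro less_le_trans [of u 0 "real k * T"]) auto
    then have "indicator {real k * T..real (Suc k) * T} u = (0::ennreal)" for k
      by (simp add: not_le del: of_nat_Suc)
    then have "occupancy rate T n u = 0" for n
      by (simp add: occupancy_def del: of_nat_Suc)
    then show ?thesis using False by (simp add: h_def)
  qed
  have "(\<integral>\<^sup>+\<omega>. \<integral>\<^sup>+u. c (N u \<omega>) * indicator {0..<\<tau> \<omega>} u \<partial>lborel \<partial>M) = (\<integral>\<^sup>+\<omega>. \<integral>\<^sup>+u. h \<omega> u \<partial>lborel \<partial>M)"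
    by (intro nn_integral_cong) (auto simp: h_def indicator_def max_def)
  also have "\<dots> = (\<integral>\<^sup>+u. \<integral>\<^sup>+\<omega>. h \<omega> u \<partial>M \<partial>lborel)"
    by (rule Fubini' [OF h, symmetric])
  also have "\<dots> = (\<integral>\<^sup>+u. (\<Sum>n. c n * indicator L n * occupancy rate T n u) \<partial>lborel)"
  proof (rule nn_integral_cong_AE)
    have "AE u in lborel. \<forall>k::nat. u \<noteq> real k * T"
      by (simp add: AE_all_countable AE_lborel_singleton)
    then show "AE u in lborel. (\<integral>\<^sup>+\<omega>. h \<omega> u \<partial>M) = (\<Sum>n. c n * indicator L n * occupancy rate T n u)"
      by eventually_elim (rule inner, blast)
  qed
  also have "\<dots> = (\<Sum>n. c n * indicator L n * ennreal (load_time n (rate * T) / rate))"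
    using rate_pos T by (subst nn_integral_suminf) (auto simp: nn_integral_cmult nn_integral_occupancy)
  finally show ?thesis .
qed

text \<open>
  The rewards \<open>1\<close> and \<open>n\<close> in the preceding lemma. The bound \<open>x ^ n / fact n\<close> on the load times makes
  both series finite, so that the nonnegative integrals are the values of the Bochner integrals.
\<close>

lemma (in poisson_process) cycle_integrals:
  assumes T: "0 < T" and L: "0 \<in> L" and [measurable]: "\<tau> \<in> borel_measurable M"
    and \<tau>: "AE \<omega> in M. \<forall>u\<ge>0. u < \<tau> \<omega> \<longleftrightarrow> N u \<omega> \<in> L \<and> N (real (nat \<lfloor>u / T\<rfloor>) * T) \<omega> = 0"
  shows "expected_cycle_length M \<tau> = (\<Sum>n. indicator L n * load_time n (rate * T)) / rate"
    and "(\<integral>\<omega>. (LBINT u:{0..\<tau> \<omega>}. real (N u \<omega>)) \<partial>M)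
      = (\<Sum>n. indicator L n * (real n * load_time n (rate * T))) / rate"
proof -
  have x: "0 < rate * T" using T rate_pos by simp
  note pos = load_time_pos [OF x] and summable = summable_load_time [OF x, of L]
  \<comment> \<open>The cycle is running at time \<open>0\<close>, where the load is \<open>0 \<in> L\<close>.\<close>
  have pos_\<tau>: "AE \<omega> in M. 0 < \<tau> \<omega>"
    using \<tau> AE_space
  proof eventually_elim
    case (elim \<omega>)
    then show ?case using L N_zero [of \<omega>] by (auto dest!: spec [of _ 0])
  qed
  have sum_eq: "(\<Sum>n. ennreal (f n) * indicator L n * ennreal (load_time n (rate * T) / rate))
      = ennreal ((\<Sum>n. indicator L n * (f n * load_time n (rate * T))) / rate)"
    if f: "\<And>n. 0 \<le> f n" "summable (\<lambda>n. indicator L n * (f n * load_time n (rate * T)))" for f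
  proof -
    have "(\<Sum>n. ennreal (f n) * indicator L n * ennreal (load_time n (rate * T) / rate))
        = (\<Sum>n. ennreal (indicator L n * (f n * load_time n (rate * T)) / rate))"
      using f(1) rate_pos pos
      by (intro suminf_cong) (auto simp: indicator_def ennreal_mult [symmetric] less_imp_le)
    also have "\<dots> = ennreal ((\<Sum>n. indicator L n * (f n * load_time n (rate * T))) / rate)"
      using f rate_pos pos
      by (intro suminf_ennreal_eq sums_divide summable_sums)
         (auto intro!: divide_nonneg_pos mult_nonneg_nonneg simp: less_imp_le)
    finally show ?thesis .
  qed
  have nonneg: "0 \<le> (\<Sum>n. indicator L n * load_time n (rate * T)) / rate"
    "0 \<le> (\<Sum>n. indicator L n * (real n * load_time n (rate * T))) / rate"
    using rate_pos pos summable by (auto intro!: divide_nonneg_pos suminf_nonneg mult_nonneg_nonneg simp: less_imp_le)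
  have "expected_cycle_length M \<tau> = enn2real (\<integral>\<^sup>+\<omega>. ennreal (\<tau> \<omega>) \<partial>M)"
    unfolding expected_cycle_length_def using pos_\<tau> by (intro integral_eq_nn_integral) auto
  also have "(\<integral>\<^sup>+\<omega>. ennreal (\<tau> \<omega>) \<partial>M) = (\<integral>\<^sup>+\<omega>. \<integral>\<^sup>+u. ennreal 1 * indicator {0..<\<tau> \<omega>} u \<partial>lborel \<partial>M)"
    using pos_\<tau> by (intro nn_integral_cong_AE) (auto elim!: eventually_mono)
  also have "\<dots> = ennreal ((\<Sum>n. indicator L n * (1 * load_time n (rate * T))) / rate)"
    using nn_integral_cycle [OF T assms(3) \<tau>, of "\<lambda>n. ennreal 1"] sum_eq [of "\<lambda>_. 1"] summable by simp
  finally show "expected_cycle_length M \<tau> = (\<Sum>n. indicator L n * load_time n (rate * T)) / rate"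
    using nonneg by simp
  define h where "h = (\<lambda>(\<omega>, u). indicator {0..\<tau> \<omega>} u * real (N (max 0 u) \<omega>))"
  have "(\<lambda>x. real (case x of (\<omega>, u) \<Rightarrow> N (max 0 u) \<omega>)) \<in> borel_measurable (M \<Otimes>\<^sub>M lborel)"
    by (rule measurable_compose [OF measurable_path]) simp
  then have [measurable]: "(\<lambda>x. real (N (max 0 (snd x)) (fst x))) \<in> borel_measurable (M \<Otimes>\<^sub>M lborel)"
    by (simp add: split_beta')
  have "(\<lambda>x. (if 0 \<le> snd x \<and> snd x \<le> \<tau> (fst x) then 1 else 0) * real (N (max 0 (snd x)) (fst x)))
      \<in> borel_measurable (M \<Otimes>\<^sub>M lborel)"
    by measurable
  then have h [measurable]: "h \<in> borel_measurable (M \<Otimes>\<^sub>M lborel)"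
    by (simp add: h_def split_beta' indicator_def)
  have h_section: "(\<lambda>\<omega>. \<integral>u. h (\<omega>, u) \<partial>lborel) \<in> borel_measurable M"
    by measurable
  have inner: "(LBINT u:{0..\<tau> \<omega>}. real (N u \<omega>)) = (\<integral>u. h (\<omega>, u) \<partial>lborel)" for \<omega>
    unfolding set_lebesgue_integral_def
    by (intro Bochner_Integration.integral_cong) (auto simp: h_def indicator_def max_def)
  have hint: "ennreal (\<integral>u. h (\<omega>, u) \<partial>lborel) = (\<integral>\<^sup>+u. ennreal (h (\<omega>, u)) \<partial>lborel)"
    if "\<omega> \<in> space M" for \<omega>
  proof (rule nn_integral_eq_integral [symmetric])
    have path: "(\<lambda>u. h (\<omega>, u)) \<in> borel_measurable lborel"
      using that by measurable
    show "integrable lborel (\<lambda>u. h (\<omega>, u))"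
    proof (rule integrableI_bounded_set [where A = "{0..\<tau> \<omega>}" and B = "real (N (max 0 (\<tau> \<omega>)) \<omega>)"])
      show "AE u in lborel. u \<in> {0..\<tau> \<omega>} \<longrightarrow> norm (h (\<omega>, u)) \<le> real (N (max 0 (\<tau> \<omega>)) \<omega>)"
        using that by (intro AE_I2) (auto simp: h_def indicator_def intro!: N_mono)
    qed (rule path | rule AE_I2 | simp add: h_def emeasure_lborel_Icc_eq)+
  qed (auto simp: h_def)
  have "(\<integral>\<omega>. (LBINT u:{0..\<tau> \<omega>}. real (N u \<omega>)) \<partial>M) = enn2real (\<integral>\<^sup>+\<omega>. ennreal (\<integral>u. h (\<omega>, u) \<partial>lborel) \<partial>M)"
    unfolding inner
    by (intro integral_eq_nn_integral h_section AE_I2 Bochner_Integration.integral_nonneg)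
       (simp add: h_def)
  also have "(\<integral>\<^sup>+\<omega>. ennreal (\<integral>u. h (\<omega>, u) \<partial>lborel) \<partial>M) = (\<integral>\<^sup>+\<omega>. \<integral>\<^sup>+u. ennreal (h (\<omega>, u)) \<partial>lborel \<partial>M)"
    by (intro nn_integral_cong hint)
  also have "\<dots> = (\<integral>\<^sup>+\<omega>. \<integral>\<^sup>+u. ennreal (real (N u \<omega>)) * indicator {0..<\<tau> \<omega>} u \<partial>lborel \<partial>M)"
  proof (rule nn_integral_cong, rule nn_integral_cong_AE)
    fix \<omega>
    show "AE u in lborel. ennreal (h (\<omega>, u)) = ennreal (real (N u \<omega>)) * indicator {0..<\<tau> \<omega>} u"
      using AE_lborel_singleton [of "\<tau> \<omega>"]
      by eventually_elim (auto simp: h_def indicator_def max_def)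
  qed
  also have "\<dots> = ennreal ((\<Sum>n. indicator L n * (real n * load_time n (rate * T))) / rate)"
    using nn_integral_cycle [OF T assms(3) \<tau>, of "\<lambda>n. ennreal (real n)"] sum_eq [of real] summable by simp
  finally show "(\<integral>\<omega>. (LBINT u:{0..\<tau> \<omega>}. real (N u \<omega>)) \<partial>M)
      = (\<Sum>n. indicator L n * (real n * load_time n (rate * T))) / rate"
    using nonneg by simp
qed

lemma (in poisson_process) AE_less_TP1_iff:
  assumes "0 < T"
  shows "AE \<omega> in M. \<forall>u\<ge>0. u < revised_TP1 N T \<omega> \<longleftrightarrow> N u \<omega> \<in> UNIV \<and> N (real (nat \<lfloor>u / T\<rfloor>) * T) \<omega> = 0"
  using AE_unbounded AE_space
  by eventually_elim (use assms in \<open>simp add: revised_TP1_def less_first_nonempty_period_iff\<close>)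

lemma (in poisson_process) AE_less_HP1_iff:
  assumes "0 < T"
  shows "AE \<omega> in M. \<forall>u\<ge>0. u < revised_HP1 N q T \<omega> \<longleftrightarrow> N u \<omega> \<in> {..<q} \<and> N (real (nat \<lfloor>u / T\<rfloor>) * T) \<omega> = 0"
  using AE_unbounded AE_space
  by eventually_elim (use assms in \<open>simp add: revised_HP1_def less_first_nonempty_period_iff less_arrival_time_iff\<close>)

section \<open>Comparison of the policies\<close>

lemma (in poisson_process) HP1_delay_less:
  assumes q: "1 \<le> q" "{..q} \<subseteq> L" and T: "0 < T" "0 < T'"
    and \<tau>: "\<tau> \<in> borel_measurable M"
      "AE \<omega> in M. \<forall>u\<ge>0. u < \<tau> \<omega> \<longleftrightarrow> N u \<omega> \<in> L \<and> N (real (nat \<lfloor>u / T'\<rfloor>) * T') \<omega> = 0"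
    and eq: "expected_cycle_length M (revised_HP1 N q T) = expected_cycle_length M \<tau>"
  shows "average_order_delay M rate N (revised_HP1 N q T) < average_order_delay M rate N \<tau>"
proof -
  have x: "0 < rate * T" "0 < rate * T'" using T rate_pos by auto
  have fin: "(\<Sum>n. indicator {..<q} n * f n) = (\<Sum>n<q. f n)" for f :: "nat \<Rightarrow> real"
    by (subst suminf_finite [of "{..<q}"]) (auto intro!: sum.cong)
  have "0 \<in> {..<q}" "0 \<in> L" using q by auto
  note HP1 = cycle_integrals [OF T(1) this(1) measurable_HP1 [OF T(1)] AE_less_HP1_iff [OF T(1)], unfolded fin]
  note G = cycle_integrals [OF T(2) \<open>0 \<in> L\<close> \<tau>]
  have "(\<Sum>n<q. load_time n (rate * T)) = (\<Sum>n. indicator L n * load_time n (rate * T'))"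
    using eq rate_pos unfolding HP1 G by simp
  then have "(\<Sum>n<q. real n * load_time n (rate * T)) < (\<Sum>n. indicator L n * (real n * load_time n (rate * T')))"
    by (rule load_sum_comparison [OF q x])
  moreover have "0 < expected_cycle_length M (revised_HP1 N q T)"
    unfolding HP1 using q rate_pos load_time_pos [OF x(1)]
    by (intro divide_pos_pos sum_pos) (auto simp: lessThan_empty_iff)
  ultimately show ?thesis
    using rate_pos unfolding average_order_delay_def eq [symmetric] HP1(2) G(2)
    by (intro divide_strict_right_mono mult_pos_pos) auto
qed

theorem theoremA2:
  fixes M :: "'a measure" and rate :: real and N :: "real \<Rightarrow> 'a \<Rightarrow> nat"
  assumes "poisson_process M rate N"
  shows "(\<forall>(q::nat) (q'::nat) (T::real) (T'::real).
            1 \<le> q \<and> q < q' \<and> 0 < T \<and> 0 < T' \<and>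
            expected_cycle_length M (revised_HP1 N q T) = expected_cycle_length M (revised_HP1 N q' T')
            \<longrightarrow> average_order_delay M rate N (revised_HP1 N q T)
                < average_order_delay M rate N (revised_HP1 N q' T'))
       \<and> (\<forall>(q::nat) (T::real) (T'::real).
            1 \<le> q \<and> 0 < T \<and> 0 < T' \<and>
            expected_cycle_length M (revised_HP1 N q T) = expected_cycle_length M (revised_TP1 N T')
            \<longrightarrow> average_order_delay M rate N (revised_HP1 N q T)
                < average_order_delay M rate N (revised_TP1 N T'))"
proof -
  interpret poisson_process M rate N by (rule assms)
  show ?thesis
  proof (intro conjI allI impI; elim conjE)
    fix q q' :: nat and T T' :: real
    assume "1 \<le> q" "q < q'" "0 < T" "0 < T'"
      and eq: "expected_cycle_length M (revised_HP1 N q T) = expected_cycle_length M (revised_HP1 N q' T')"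
    moreover from \<open>q < q'\<close> have "{..q} \<subseteq> {..<q'}" by auto
    ultimately show "average_order_delay M rate N (revised_HP1 N q T)
        < average_order_delay M rate N (revised_HP1 N q' T')"
      by (intro HP1_delay_less [where L = "{..<q'}" and T' = T'] measurable_HP1 AE_less_HP1_iff)
  next
    fix q :: nat and T T' :: real
    assume "1 \<le> q" "0 < T" "0 < T'"
      and eq: "expected_cycle_length M (revised_HP1 N q T) = expected_cycle_length M (revised_TP1 N T')"
    then show "average_order_delay M rate N (revised_HP1 N q T)
        < average_order_delay M rate N (revised_TP1 N T')"
      by (intro HP1_delay_less [where L = UNIV and T' = T'] measurable_TP1 AE_less_TP1_iff) auto
  qed
qed

end
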